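(* For every integer $m\ge 1$, $\pi^*(C_5^{2m})\le \frac{44}{25}\,5^m$. For every integer $d\ge 1$, $\pi^*(C_5^d)\le \frac{4}{\sqrt5}\,5^{d/2}$; in particular $\pi^*(C_5^d)\in O(\sqrt5^{\,d})$.
   Context: A distribution on a graph $G=(V,E)$ is a function $D:V\to\mathbb{N}$, with size $|D|=\sum_v D(v)$. A pebbling move removes two pebbles from a vertex having at least two pebbles and places one pebble on a neighbor. A distribution is solvable if for every vertex $v$, some sequence of pebbling moves starting from it results in a distribution with at least one pebble on $v$. The optimal pebbling number $\pi^*(G)$ is the minimum size of a solvable distribution on $G$. $C_5^d$ denotes the $d$-fold Cartesian product of the 5-cycle $C_5$ with itself. *)

theory Defs
  imports
    Complex_Main
    "HOL-Library.Landau_Symbols"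
    "Graph_Theory.Pair_Digraph"
begin

text \<open>
  A finite simple graph is a \<^locale>\<open>pair_graph\<close>: a finite, loop-free \<^typ>\<open>'a pair_pre_digraph\<close>
  whose arc relation is symmetric.
\<close>

text \<open>The cycle on the residues modulo \<open>n\<close>; a simple cycle for \<open>n \<ge> 3\<close>.\<close>

definition cycle_graph :: "nat \<Rightarrow> nat pair_pre_digraph" where
  "cycle_graph n =
    \<lparr> pverts = {..<n},
      parcs = {(i, j). i < n \<and> j < n \<and> (j = (i + 1) mod n \<or> i = (j + 1) mod n)} \<rparr>"

text \<open>
  The \<open>d\<close>-fold Cartesian product of \<open>G\<close> with itself. The vertex tuples are lists of length \<open>d\<close>, so
  that \<open>d\<close> is an ordinary natural number and all powers of \<open>G\<close> have the same vertex type.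
\<close>

definition cartesian_power :: "'a pair_pre_digraph \<Rightarrow> nat \<Rightarrow> 'a list pair_pre_digraph" where
  "cartesian_power G d =
    (let V = {xs. length xs = d \<and> set xs \<subseteq> pverts G} in
     \<lparr> pverts = V,
       parcs = {(xs, ys). xs \<in> V \<and> ys \<in> V \<and>
         (\<exists>i<d. (xs ! i, ys ! i) \<in> parcs G \<and> (\<forall>j<d. j \<noteq> i \<longrightarrow> xs ! j = ys ! j))} \<rparr>)"

text \<open>A function on the vertex set is represented by a total function vanishing elsewhere.\<close>

definition distributions :: "'a pair_pre_digraph \<Rightarrow> ('a \<Rightarrow> nat) set" where
  "distributions G = {D. \<forall>v. v \<notin> pverts G \<longrightarrow> D v = 0}"

definition dist_size :: "'a pair_pre_digraph \<Rightarrow> ('a \<Rightarrow> nat) \<Rightarrow> nat" where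
  "dist_size G D = (\<Sum>v\<in>pverts G. D v)"

text \<open>The simultaneous update is the intended one because \<open>u \<noteq> v\<close> in a loop-free graph.\<close>

definition pebbling_move :: "'a pair_pre_digraph \<Rightarrow> ('a \<Rightarrow> nat) \<Rightarrow> ('a \<Rightarrow> nat) \<Rightarrow> bool" where
  "pebbling_move G D D' \<longleftrightarrow>
    (\<exists>u v. (u, v) \<in> parcs G \<and> D u \<ge> 2 \<and> D' = D(u := D u - 2, v := D v + 1))"

definition solvable :: "'a pair_pre_digraph \<Rightarrow> ('a \<Rightarrow> nat) \<Rightarrow> bool" where
  "solvable G D \<longleftrightarrow> (\<forall>v\<in>pverts G. \<exists>D'. (pebbling_move G)\<^sup>*\<^sup>* D D' \<and> D' v \<ge> 1)"

definition optimal_pebbling_number :: "'a pair_pre_digraph \<Rightarrow> nat" where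
  "optimal_pebbling_number G =
    (LEAST n. \<exists>D\<in>distributions G. solvable G D \<and> dist_size G D = n)"

text \<open>
  The minimum is always attained, since the distribution with one pebble on every vertex is
  solvable.
\<close>

lemma optimal_pebbling_number_attained:
  "\<exists>D\<in>distributions G. solvable G D \<and> dist_size G D = optimal_pebbling_number G"
proof -
  define D where "D = (\<lambda>v. if v \<in> pverts G then 1 else 0 :: nat)"
  have "D \<in> distributions G" "solvable G D"
    by (auto simp: D_def distributions_def solvable_def)
  then have "\<exists>n. \<exists>D\<in>distributions G. solvable G D \<and> dist_size G D = n"
    by blast
  then show ?thesis
    unfolding optimal_pebbling_number_def by (rule LeastI_ex)
qed

lemma pair_graph_cycle_graph:
  assumes "n \<ge> 3"
  shows "pair_graph (cycle_graph n)"
proof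
  show "finite (parcs (cycle_graph n))"
    by (rule finite_subset[of _ "{..<n} \<times> {..<n}"]) (auto simp: cycle_graph_def)
  show "fst e \<noteq> snd e" if "e \<in> parcs (cycle_graph n)" for e
    using that assms by (auto simp: cycle_graph_def mod_Suc split: if_splits)
  have "sym (parcs (cycle_graph n))"
    unfolding sym_def cycle_graph_def by auto
  then show "symmetric (with_proj (cycle_graph n))"
    by (simp add: symmetric_def arcs_ends_def arc_to_ends_def)
qed (auto simp: cycle_graph_def)

lemma pair_graph_cartesian_power:
  assumes "pair_graph G"
  shows "pair_graph (cartesian_power G d)"
proof -
  interpret G: pair_graph G by fact
  define V where "V = {xs. length xs = d \<and> set xs \<subseteq> pverts G}"
  have "V = {xs. set xs \<subseteq> pverts G \<and> length xs = d}"
    by (auto simp: V_def)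
  then have fin: "finite V"
    using finite_lists_length_eq[OF G.pair_finite_verts, of d] by simp
  have verts: "pverts (cartesian_power G d) = V"
    by (simp add: cartesian_power_def V_def)
  have arcs: "(xs, ys) \<in> parcs (cartesian_power G d) \<longleftrightarrow> xs \<in> V \<and> ys \<in> V \<and>
      (\<exists>i<d. (xs ! i, ys ! i) \<in> parcs G \<and> (\<forall>j<d. j \<noteq> i \<longrightarrow> xs ! j = ys ! j))" for xs ys
    by (simp add: cartesian_power_def V_def)
  have sub: "parcs (cartesian_power G d) \<subseteq> V \<times> V"
    using arcs by (intro subrelI) blast
  have sym: "sym (parcs G)"
    using G.pair_sym_arcs by (simp add: symmetric_def arcs_ends_def arc_to_ends_def)
  have sym': "sym (parcs (cartesian_power G d))"
    unfolding sym_def arcs by (metis sym symD)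
  show ?thesis
  proof
    show "fst e \<noteq> snd e" if "e \<in> parcs (cartesian_power G d)" for e
    proof -
      have "(fst e, snd e) \<in> parcs (cartesian_power G d)"
        using that by simp
      then obtain i where i: "(fst e ! i, snd e ! i) \<in> parcs G"
        unfolding arcs by blast
      show ?thesis
        using G.pair_no_loops[OF i] by auto
    qed
    show "symmetric (with_proj (cartesian_power G d))"
      using sym' by (simp add: symmetric_def arcs_ends_def arc_to_ends_def)
  qed (use sub fin in \<open>auto simp: verts intro: finite_subset\<close>)
qed

end

theory Submission
  imports Defs
begin

text \<open>
  Write \<open>\<Delta> = {(c, c)}\<close> for the diagonal of \<open>C\<^sub>5\<^sup>2\<close>. Four pebbles on each of its five vertices can be
  turned into four pebbles on any prescribed vertex of \<open>C\<^sub>5\<^sup>2\<close>. Working fibre by fibre, a distribution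
  on \<open>C\<^sub>5\<^sup>n\<close> that solves every target by way of a distribution whose values are all multiples of four
  yields one on \<open>C\<^sub>5\<^sup>n\<^sup>+\<^sup>2\<close> with the same property and five times the size.
  Odd exponents start from four pebbles on a vertex of \<open>C\<^sub>5\<close>.

  Even exponents start from \<open>C\<^sub>5 \<times> C\<^sub>5\<^sup>3\<close> and size 43. The graph \<open>C\<^sub>5\<^sup>3\<close> is solved by stacks of
  8, 8 and 4 pebbles on \<open>000\<close>, \<open>222\<close> and \<open>333\<close>; and \<open>(4,3,3,4,3)\<close> and \<open>(3,1,2,2,1)\<close> are
  distributions on \<open>C\<^sub>5\<close> from which 8, respectively 4, pebbles can be brought to any vertex.
  They replace the stacks at the cost \<open>17 + 17 + 9 = 43\<close>. The square \<open>C\<^sub>5\<^sup>2\<close> itself is solved by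
  stacks of 4, 2 and 2 pebbles on \<open>00\<close>, \<open>22\<close> and \<open>33\<close>.
\<close>

section \<open>Reachability between multisets of pebbles\<close>

text \<open>The rule \<open>sub\<close> discards pebbles, so \<open>N\<close> is a demand to be met
  rather than the exact outcome. With multisets, plays on disjoint supplies simply add, and
  arc-preserving maps carry plays to plays.\<close>

inductive reaches :: "'a pair_pre_digraph \<Rightarrow> 'a multiset \<Rightarrow> 'a multiset \<Rightarrow> bool"
  for G :: "'a pair_pre_digraph" where
  sub: "N \<subseteq># M \<Longrightarrow> reaches G M N"
| step: "(u, v) \<in> parcs G \<Longrightarrow> reaches G (add_mset v M) N \<Longrightarrow> reaches G (add_mset u (add_mset u M)) N"

lemma reaches_refl: "reaches G M M"
  by (simp add: reaches.sub)

lemma reaches_mono: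
  assumes "reaches G M N"
  shows "reaches G (M + K) (N + K)"
  using assms
proof induction
  case (sub N M)
  then show ?case by (simp add: reaches.sub)
next
  case (step u v M N)
  then show ?case
    using reaches.step[of u v G "M + K" "N + K"] by simp
qed

lemma reaches_weaken:
  assumes "reaches G M N" "K \<subseteq># N"
  shows "reaches G M K"
  using assms by induction (auto intro: reaches.intros subset_mset.order_trans)

lemma reaches_trans [trans]:
  assumes "reaches G M N" "reaches G N K"
  shows "reaches G M K"
  using assms
proof induction
  case (sub N M)
  then obtain L where "M = N + L"
    by (metis subset_mset.add_diff_inverse)
  then show ?case
    using reaches_mono[OF sub.prems, of L] by (metis reaches_weaken mset_subset_eq_add_left)
next
  case (step u v M N)
  then show ?case by (simp add: reaches.step)
qed

lemma reaches_add:
  assumes "reaches G M N" "reaches G M' N'"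
  shows "reaches G (M + M') (N + N')"
  using reaches_mono[OF assms(1), of M'] reaches_mono[OF assms(2), of N]
  by (metis reaches_trans union_commute)

lemma reaches_sum_mset:
  assumes "\<And>x. x \<in># A \<Longrightarrow> reaches G (f x) (g x)"
  shows "reaches G (\<Sum>x\<in>#A. f x) (\<Sum>x\<in>#A. g x)"
  using assms by (induction A) (auto intro: reaches_refl reaches_add)

lemma reaches_image:
  assumes "reaches G M N" "\<And>u v. (u, v) \<in> parcs G \<Longrightarrow> (f u, f v) \<in> parcs H"
  shows "reaches H (image_mset f M) (image_mset f N)"
  using assms(1)
proof induction
  case (sub N M)
  then show ?case by (simp add: reaches.sub image_mset_subseteq_mono)
next
  case (step u v M N)
  then show ?case
    using reaches.step[of "f u" "f v" H "image_mset f M"] assms(2) by simp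
qed

text \<open>Each edge of a walk halves the stack that is pushed across it.\<close>

lemma reaches_path:
  assumes "(u, v) \<in> parcs G ^^ d"
  shows "reaches G (replicate_mset (k * 2 ^ d) u) (replicate_mset k v)"
  using assms
proof (induction d arbitrary: u k)
  case 0
  then show ?case by (simp add: reaches_refl)
next
  case (Suc d)
  then obtain w where w: "(u, w) \<in> parcs G" "(w, v) \<in> parcs G ^^ d"
    by (meson relpow_Suc_D2)
  have "reaches G (replicate_mset (2 * j) u) (replicate_mset j w)" for j
  proof (induction j)
    case 0
    then show ?case by (simp add: reaches_refl)
  next
    case (Suc j)
    have "reaches G {#u, u#} {#w#}"
      using reaches.step[OF w(1), of "{#}"] by (simp add: reaches_refl)
    from reaches_add[OF this Suc] show ?case by simp
  qed
  from reaches_trans[OF this Suc.IH[OF w(2), of k]] show ?case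
    by (simp add: mult.left_commute)
qed

text \<open>Pebbles discarded by \<open>sub\<close> merely stay on the board in an actual play.
  Loop-freeness makes the two function updates of a move agree with the change of the
  multiset.\<close>

lemma reaches_sound:
  assumes "reaches G M N" "v \<in># N" and loopfree: "\<And>u. (u, u) \<notin> parcs G"
  shows "\<exists>D. (pebbling_move G)\<^sup>*\<^sup>* (count M) D \<and> D v \<ge> 1"
  using assms(1,2)
proof induction
  case (sub N M)
  then have "count M v \<ge> 1"
    by (metis mset_subset_eqD count_greater_eq_one_iff)
  then show ?case by blast
next
  case (step x y M N)
  define M' where "M' = add_mset x (add_mset x M)"
  have "x \<noteq> y" using step.hyps(1) loopfree by blast
  then have "count (add_mset y M) = (count M')(x := count M' x - 2, y := count M' y + 1)"
    by (auto simp: fun_eq_iff M'_def)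
  moreover have "count M' x \<ge> 2" by (simp add: M'_def)
  ultimately have move: "pebbling_move G (count M') (count (add_mset y M))"
    unfolding pebbling_move_def using step.hyps(1) by blast
  obtain D where "(pebbling_move G)\<^sup>*\<^sup>* (count (add_mset y M)) D" "D v \<ge> 1"
    using step.IH step.prems by blast
  with converse_rtranclp_into_rtranclp[of "pebbling_move G", OF move] show ?case
    unfolding M'_def by blast
qed

lemma optimal_pebbling_number_le:
  assumes "pair_graph G" "set_mset M \<subseteq> pverts G" "\<And>v. v \<in> pverts G \<Longrightarrow> reaches G M {#v#}"
  shows "optimal_pebbling_number G \<le> size M"
proof -
  interpret pair_graph G by fact
  have "(u, u) \<notin> parcs G" for u
    using pair_no_loops by fastforce
  then have "solvable G (count M)"
    unfolding solvable_def using reaches_sound[OF assms(3)] by (metis multi_member_last)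
  moreover have "count M \<in> distributions G"
    using assms(2) by (auto simp: distributions_def count_eq_zero_iff)
  moreover have "dist_size G (count M) = size M"
    unfolding dist_size_def size_multiset_overloaded_eq
    using assms(2) by (intro sum.mono_neutral_right) (auto simp: count_eq_zero_iff)
  ultimately show ?thesis
    unfolding optimal_pebbling_number_def by (intro Least_le) blast
qed

section \<open>Cartesian powers\<close>

lemma pverts_cartesian_power:
  "pverts (cartesian_power G d) = {xs. length xs = d \<and> set xs \<subseteq> pverts G}"
  by (simp add: cartesian_power_def)

lemma parcs_cartesian_power:
  "(xs, ys) \<in> parcs (cartesian_power G d) \<longleftrightarrow>
    xs \<in> pverts (cartesian_power G d) \<and> ys \<in> pverts (cartesian_power G d) \<and>
    (\<exists>i<d. (xs ! i, ys ! i) \<in> parcs G \<and> (\<forall>j<d. j \<noteq> i \<longrightarrow> xs ! j = ys ! j))"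
  by (simp add: cartesian_power_def)

lemma parcs_append_left:
  assumes "(xs, ys) \<in> parcs (cartesian_power G n)" "zs \<in> pverts (cartesian_power G m)"
  shows "(zs @ xs, zs @ ys) \<in> parcs (cartesian_power G (m + n))"
proof -
  obtain i where "i < n" "(xs ! i, ys ! i) \<in> parcs G" "\<forall>j<n. j \<noteq> i \<longrightarrow> xs ! j = ys ! j"
    using assms(1) by (auto simp: parcs_cartesian_power)
  with assms show ?thesis
    unfolding parcs_cartesian_power
    by (auto simp: pverts_cartesian_power nth_append intro!: exI[of _ "m + i"])
qed

lemma parcs_append_right:
  assumes "(xs, ys) \<in> parcs (cartesian_power G n)" "zs \<in> pverts (cartesian_power G m)"
  shows "(xs @ zs, ys @ zs) \<in> parcs (cartesian_power G (n + m))"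
proof -
  obtain i where "i < n" "(xs ! i, ys ! i) \<in> parcs G" "\<forall>j<n. j \<noteq> i \<longrightarrow> xs ! j = ys ! j"
    using assms(1) by (auto simp: parcs_cartesian_power)
  with assms show ?thesis
    unfolding parcs_cartesian_power
    by (auto simp: pverts_cartesian_power nth_append intro!: exI[of _ i])
qed

lemma parcs_singleton:
  assumes "pair_graph G" "(x, y) \<in> parcs G"
  shows "([x], [y]) \<in> parcs (cartesian_power G 1)"
proof -
  interpret pair_graph G by fact
  show ?thesis
    using assms(2) in_arcsD1 in_arcsD2
    by (auto simp: parcs_cartesian_power pverts_cartesian_power)
qed

section \<open>Powers of the five-cycle\<close>

abbreviation C5 :: "nat pair_pre_digraph" where
  "C5 \<equiv> cycle_graph 5"

lemma pair_graph_C5: "pair_graph C5"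
  by (simp add: pair_graph_cycle_graph)

lemma pverts_C5: "pverts C5 = {..<5}"
  by (simp add: cycle_graph_def)

text \<open>The summand 5 keeps the natural subtraction from truncating on residues.\<close>

definition cycle_dist :: "nat \<Rightarrow> nat \<Rightarrow> nat" where
  "cycle_dist x y = min ((x + 5 - y) mod 5) ((y + 5 - x) mod 5)"

fun list_dist :: "nat list \<Rightarrow> nat list \<Rightarrow> nat" where
  "list_dist (x # xs) (y # ys) = cycle_dist x y + list_dist xs ys"
| "list_dist _ _ = 0"

lemma less_5_cases: "(x::nat) < 5 \<Longrightarrow> x = 0 \<or> x = 1 \<or> x = 2 \<or> x = 3 \<or> x = 4"
  by auto

lemma cycle_path:
  assumes "x < 5" "y < 5"
  shows "(x, y) \<in> parcs C5 ^^ cycle_dist x y"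
proof -
  have two: "(x, y) \<in> parcs C5 ^^ 2" if "\<exists>z. (x, z) \<in> parcs C5 \<and> (z, y) \<in> parcs C5"
    using that by (auto simp: numeral_2_eq_2)
  consider "cycle_dist x y = 0" "x = y" | "cycle_dist x y = 1" "(x, y) \<in> parcs C5"
    | "cycle_dist x y = 2" "\<exists>z\<in>{0, 1, 2, 3, 4}. (x, z) \<in> parcs C5 \<and> (z, y) \<in> parcs C5"
    using assms[THEN less_5_cases]
    by (elim disjE) (simp_all add: cycle_dist_def cycle_graph_def)
  then show ?thesis
    using two by cases auto
qed

lemma relpow_image:
  assumes "(u, v) \<in> R ^^ d" "\<And>u v. (u, v) \<in> R \<Longrightarrow> (f u, f v) \<in> S"
  shows "(f u, f v) \<in> S ^^ d"
  using assms(1)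
proof (induction d arbitrary: v)
  case (Suc d)
  then show ?case using assms(2) by (auto intro: relpow_Suc_I)
qed simp

text \<open>The coordinates are changed one after the other, starting with the first, and the walks
  are concatenated.\<close>

lemma list_path:
  assumes "xs \<in> pverts (cartesian_power C5 n)" "ys \<in> pverts (cartesian_power C5 n)"
  shows "(xs, ys) \<in> parcs (cartesian_power C5 n) ^^ list_dist xs ys"
  using assms
proof (induction xs ys arbitrary: n rule: list_dist.induct)
  case (1 x xs y ys)
  obtain m where m: "n = 1 + m"
    using "1.prems" by (cases n) (auto simp: pverts_cartesian_power)
  have V: "xs \<in> pverts (cartesian_power C5 m)" "ys \<in> pverts (cartesian_power C5 m)"
    "x < 5" "y < 5" "[y] \<in> pverts (cartesian_power C5 1)"
    using "1.prems" by (auto simp: m pverts_cartesian_power pverts_C5)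
  have "([x] @ xs, [y] @ xs) \<in> parcs (cartesian_power C5 n) ^^ cycle_dist x y"
    unfolding m using V
    by (intro relpow_image[OF cycle_path, of x y "\<lambda>x. [x] @ xs"] parcs_append_right
        parcs_singleton pair_graph_C5)
  moreover have "([y] @ xs, [y] @ ys) \<in> parcs (cartesian_power C5 n) ^^ list_dist xs ys"
    unfolding m using V "1.IH"
    by (intro relpow_image[of xs ys _ _ "\<lambda>xs. [y] @ xs"] parcs_append_left)
  ultimately show ?case
    by (auto simp: relpow_add)
qed (auto simp: pverts_cartesian_power)

section \<open>Solving small powers by gathering stacks\<close>

abbreviation stacks :: "('a \<times> nat) list \<Rightarrow> 'a multiset" where
  "stacks us \<equiv> \<Sum>(u, s)\<leftarrow>us. replicate_mset s u"

text \<open>The stacks are first gathered on the intermediate vertex \<open>w\<close>.\<close>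

lemma reaches_via:
  assumes "w \<in> pverts (cartesian_power C5 n)" "v \<in> pverts (cartesian_power C5 n)"
    and "fst ` set us \<subseteq> pverts (cartesian_power C5 n)"
    and "k * 2 ^ list_dist w v \<le> (\<Sum>(u, s)\<leftarrow>us. s div 2 ^ list_dist u w)"
  shows "reaches (cartesian_power C5 n) (stacks us) (replicate_mset k v)"
proof -
  have "reaches (cartesian_power C5 n) (stacks us)
      (replicate_mset (\<Sum>(u, s)\<leftarrow>us. s div 2 ^ list_dist u w) w)"
    using assms(3)
  proof (induction us)
    case (Cons p us)
    obtain u s where p: "p = (u, s)" by force
    \<comment> \<open>The remainder of \<open>s\<close> modulo the power of two is thrown
      away.\<close>
    have "reaches (cartesian_power C5 n) (replicate_mset s u)
        (replicate_mset (s div 2 ^ list_dist u w * 2 ^ list_dist u w) u)"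
      by (rule reaches.sub) (simp add: subseteq_mset_def)
    also have "reaches (cartesian_power C5 n) \<dots> (replicate_mset (s div 2 ^ list_dist u w) w)"
      using Cons.prems assms(1) by (intro reaches_path list_path) (auto simp: p)
    finally have first: "reaches (cartesian_power C5 n) (replicate_mset s u)
        (replicate_mset (s div 2 ^ list_dist u w) w)" .
    have "replicate_mset (i + j) w = replicate_mset i w + replicate_mset j w" for i j
      by (simp add: multiset_eq_iff)
    with reaches_add[OF first Cons.IH] Cons.prems show ?case
      by (simp add: p)
  qed (simp add: reaches_refl)
  also have "reaches (cartesian_power C5 n) \<dots> (replicate_mset (k * 2 ^ list_dist w v) w)"
    using assms(4) by (intro reaches.sub) (simp add: subseteq_mset_def)
  also have "reaches (cartesian_power C5 n) \<dots> (replicate_mset k v)"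
    using assms by (intro reaches_path list_path)
  finally show ?thesis .
qed

text \<open>The vertex set as an explicit list, so that claims about all vertices can be
  evaluated.\<close>

lemma pverts_C5_power:
  "pverts (cartesian_power C5 n) = set (product_lists (replicate n [0..<5]))"
  unfolding product_lists_set pverts_cartesian_power pverts_C5
  by (auto simp: list_all2_conv_all_nth subset_eq all_set_conv_all_nth)

lemma four_on_C5:
  assumes "v < 5"
  shows "reaches (cartesian_power C5 1) (replicate_mset 4 [0]) {#[v]#}"
proof -
  have "1 * 2 ^ list_dist [0] [v] \<le> (\<Sum>(u, s)\<leftarrow>[([0], 4 :: nat)]. s div 2 ^ list_dist u [0])"
    using less_5_cases[OF assms] by (auto simp: cycle_dist_def)
  from reaches_via[OF _ _ _ this] show ?thesis
    using assms by (simp add: pverts_cartesian_power pverts_C5)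
qed

lemma solves_C5_square:
  assumes "v \<in> pverts (cartesian_power C5 2)"
  shows "reaches (cartesian_power C5 2) (stacks [([0,0], 4), ([2,2], 2), ([3,3], 2)]) {#v#}"
proof -
  let ?us = "[([0,0], 4), ([2,2], 2), ([3,3], 2 :: nat)]"
  \<comment> \<open>Besides the stacks themselves: the two common neighbours of 22 and 33, each of
    which can receive one pebble from both.\<close>
  let ?ws = "[[0,0], [2,2], [3,3], [2,3], [3,2]]"
  have "\<forall>v \<in> set (product_lists (replicate 2 [0..<5])). \<exists>w \<in> set ?ws.
        1 * 2 ^ list_dist w v \<le> (\<Sum>(u, s)\<leftarrow>?us. s div 2 ^ list_dist u w)"
    by code_simp
  then obtain w where w: "w \<in> set ?ws"
      "1 * 2 ^ list_dist w v \<le> (\<Sum>(u, s)\<leftarrow>?us. s div 2 ^ list_dist u w)"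
    using assms unfolding pverts_C5_power by blast
  show ?thesis
    using reaches_via[OF _ assms _ w(2)] w(1)
    by (auto simp: pverts_cartesian_power pverts_C5)
qed

lemma solves_C5_cube:
  assumes "v \<in> pverts (cartesian_power C5 3)"
  shows "reaches (cartesian_power C5 3) (stacks [([0,0,0], 8), ([2,2,2], 8), ([3,3,3], 4)]) {#v#}"
proof -
  let ?us = "[([0,0,0], 8), ([2,2,2], 8), ([3,3,3], 4 :: nat)]"
  \<comment> \<open>The last three vertices are neighbours of 333 at distance two from 222, and two
    pebbles arrive from either stack.\<close>
  let ?ws = "[[0,0,0], [2,2,2], [3,3,3], [2,3,3], [3,2,3], [3,3,2]]"
  have "\<forall>v \<in> set (product_lists (replicate 3 [0..<5])). \<exists>w \<in> set ?ws.
        1 * 2 ^ list_dist w v \<le> (\<Sum>(u, s)\<leftarrow>?us. s div 2 ^ list_dist u w)"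
    by code_simp
  then obtain w where w: "w \<in> set ?ws"
      "1 * 2 ^ list_dist w v \<le> (\<Sum>(u, s)\<leftarrow>?us. s div 2 ^ list_dist u w)"
    using assms unfolding pverts_C5_power by blast
  show ?thesis
    using reaches_via[OF _ assms _ w(2)] w(1)
    by (auto simp: pverts_cartesian_power pverts_C5)
qed

section \<open>The diagonal of the square\<close>

lemma diagonal_supplies_4:
  assumes "v \<in> pverts (cartesian_power C5 2)"
  shows "reaches (cartesian_power C5 2) (\<Sum>c\<in>#mset [0..<5]. replicate_mset 4 [c, c])
    (replicate_mset 4 v)"
proof -
  let ?G = "cartesian_power C5 2"
  let ?D = "\<lambda>cs. stacks (map (\<lambda>c. ([c, c], 4 :: nat)) cs)"
  let ?ok = "\<lambda>cs w v k. (\<forall>c \<in> set cs. c < 5) \<and> w \<in> set (product_lists (replicate 2 [0..<5]))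
      \<and> k * 2 ^ list_dist w v \<le> (\<Sum>(u, s)\<leftarrow>map (\<lambda>c. ([c, c], 4 :: nat)) cs. s div 2 ^ list_dist u w)"
  \<comment> \<open>Meant for \<open>v\<close> = (\<open>c 0\<close>, \<open>c 2\<close>), where
    \<open>c\<close> runs around the cycle; the step \<open>e\<close> is 1 or 4 according to the
    direction. Four pebbles gather on (\<open>c 0\<close>, \<open>c 1\<close>), at distance one from
    \<open>v\<close>, and four on (\<open>c 4\<close>, \<open>c 3\<close>), at distance two. The
    stack on (\<open>c 2\<close>, \<open>c 2\<close>) is itself at distance two.\<close>
  let ?plan = "\<lambda>v c. mset [c 0, c 1, c 2, c 3, c 4] = mset [0..<5] \<and>
      ?ok [c 0, c 1] [c 0, c (1::nat)] v 2 \<and> ?ok [c 2] [c 2, c 2] v 1 \<and> ?ok [c 3, c 4] [c 4, c 3] v 1"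
  have ok: "reaches ?G (?D cs) (replicate_mset k v)" if "?ok cs w v k" for cs w k
    using that assms
    by (intro reaches_via[of w])
      (auto simp: pverts_C5_power[symmetric] pverts_cartesian_power pverts_C5)
  have perm: "(\<Sum>c\<in>#mset [0..<5]. replicate_mset 4 [c, c]) = ?D cs"
    if "mset cs = mset [0..<5]" for cs :: "nat list"
    unfolding that[symmetric] by (simp add: sum_mset_sum_list[symmetric] comp_def)
  txt \<open>Vertices at distance one from the diagonal get 2 + 2 pebbles from their two neighbours there;
    the remaining ones get 2 + 1 + 1.\<close>
  have "\<forall>v \<in> set (product_lists (replicate 2 [0..<5])).
      ?ok [0..<5] v v 4 \<or>
      (\<exists>e \<in> set [1, 4]. ?plan v (\<lambda>i. (hd v + i * e) mod 5))"
    by code_simp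
  then have "?ok [0..<5] v v 4 \<or> (\<exists>e \<in> set [1, 4]. ?plan v (\<lambda>i. (hd v + i * e) mod 5))"
    using assms unfolding pverts_C5_power by (rule bspec)
  then consider "?ok [0..<5] v v 4" | e where "?plan v (\<lambda>i. (hd v + i * e) mod 5)"
    by (elim disjE bexE)
  then show ?thesis
  proof cases
    case 1
    from ok[OF this] show ?thesis using perm[of "[0..<5]"] by simp
  next
    case 2
    define c where "c i = (hd v + i * e) mod 5" for i
    have plan: "?plan v c"
      using 2 unfolding c_def .
    have "reaches ?G (?D [c 0, c 1] + ?D [c 2] + ?D [c 3, c 4])
      (replicate_mset 2 v + replicate_mset 1 v + replicate_mset 1 v)"
      by (intro reaches_add ok[OF plan[THEN conjunct2, THEN conjunct1]]
          ok[OF plan[THEN conjunct2, THEN conjunct2, THEN conjunct1]]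
          ok[OF plan[THEN conjunct2, THEN conjunct2, THEN conjunct2]])
    moreover have "?D [c 0, c 1] + ?D [c 2] + ?D [c 3, c 4] = ?D [c 0, c 1, c 2, c 3, c 4]"
      by simp
    moreover have "replicate_mset 2 v + replicate_mset 1 v + replicate_mset 1 v = replicate_mset 4 v"
      by (simp add: numeral_eq_Suc)
    ultimately show ?thesis
      using perm[OF plan[THEN conjunct1]] by (simp add: add.assoc)
  qed
qed

text \<open>
  Every vertex of \<open>C\<^sub>5\<^sup>n\<close> is reached by way of a distribution all of whose values are multiples of
  four; the latter is what allows the passage from \<open>n\<close> to \<open>n + 2\<close>.
\<close>

definition solves_by_fours :: "nat \<Rightarrow> nat list multiset \<Rightarrow> bool" where
  "solves_by_fours n M \<longleftrightarrow> set_mset M \<subseteq> pverts (cartesian_power C5 n) \<and>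
    (\<forall>v \<in> pverts (cartesian_power C5 n). \<exists>T. set_mset T \<subseteq> pverts (cartesian_power C5 n) \<and>
      reaches (cartesian_power C5 n) M (repeat_mset 4 T) \<and>
      reaches (cartesian_power C5 n) (repeat_mset 4 T) {#v#})"

lemma optimal_le_solves_by_fours:
  assumes "solves_by_fours n M"
  shows "optimal_pebbling_number (cartesian_power C5 n) \<le> size M"
  using assms unfolding solves_by_fours_def
  by (intro optimal_pebbling_number_le pair_graph_cartesian_power pair_graph_C5)
    (blast intro: reaches_trans)+

lemma image_repeat_mset: "image_mset f (repeat_mset k M) = repeat_mset k (image_mset f M)"
  by (induction k) auto

lemma image_sum_mset: "image_mset g (\<Sum>x\<in>#A. f x) = (\<Sum>x\<in>#A. image_mset g (f x))"
  by (induction A) auto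

text \<open>A copy of \<open>M\<close> lies in each of the five diagonal fibres. For the target
  (\<open>v\<close>, \<open>w\<close>) every copy is played to \<open>4 T\<close>, where
  \<open>T\<close> serves \<open>w\<close>. Over each element of \<open>T\<close> there are then
  four pebbles on every diagonal vertex, which are traded for four over \<open>v\<close>. This
  yields \<open>4 T\<close> in the fibre of \<open>v\<close>, again a multiple of four.\<close>

lemma solves_by_fours_step:
  assumes "solves_by_fours n M"
  shows "\<exists>M'. solves_by_fours (2 + n) M' \<and> size M' = 5 * size M"
proof -
  let ?V = "\<lambda>n. pverts (cartesian_power C5 n)"
  let ?R = "\<lambda>n. reaches (cartesian_power C5 n)"
  define M' where "M' = (\<Sum>c\<in>#mset [0..<5]. image_mset (\<lambda>x. [c, c] @ x) M)"
  have diag: "[c, c] \<in> ?V 2" if "c \<in># mset [0..<5]" for c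
    using that by (auto simp: pverts_cartesian_power pverts_C5)
  have "\<forall>x \<in># M. x \<in> ?V n"
    using assms by (auto simp: solves_by_fours_def)
  then have "set_mset M' \<subseteq> ?V (2 + n)"
    by (fastforce simp: M'_def pverts_cartesian_power pverts_C5)
  moreover have "\<exists>T. set_mset T \<subseteq> ?V (2 + n) \<and> ?R (2 + n) M' (repeat_mset 4 T) \<and>
      ?R (2 + n) (repeat_mset 4 T) {#u#}" if u: "u \<in> ?V (2 + n)" for u
  proof -
    define v w where "v = take 2 u" and "w = drop 2 u"
    have uvw: "u = v @ w" "v \<in> ?V 2" "w \<in> ?V n"
      using u set_take_subset[of 2 u] set_drop_subset[of 2 u]
      by (auto simp: v_def w_def pverts_cartesian_power)
    then obtain T where T: "set_mset T \<subseteq> ?V n" "?R n M (repeat_mset 4 T)" "?R n (repeat_mset 4 T) {#w#}"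
      using assms unfolding solves_by_fours_def by blast
    define T' where "T' = image_mset (\<lambda>x. v @ x) T"
    have "?R (2 + n) M' (\<Sum>c\<in>#mset [0..<5]. image_mset (\<lambda>x. [c, c] @ x) (repeat_mset 4 T))"
      unfolding M'_def by (intro reaches_sum_mset reaches_image[OF T(2)] parcs_append_left diag)
    \<comment> \<open>The sums are exchanged: grouping by elements of \<open>T\<close> exposes a
      full diagonal over each of them.\<close>
    also have "\<dots> = (\<Sum>t\<in>#T. image_mset (\<lambda>y. y @ t) (\<Sum>c\<in>#mset [0..<5]. replicate_mset 4 [c, c]))"
      by (induction T) (simp_all add: sum_mset.distrib image_sum_mset del: mset_upt)
    also have "?R (2 + n) \<dots> (\<Sum>t\<in>#T. image_mset (\<lambda>y. y @ t) (replicate_mset 4 v))"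
      using T(1)
      by (intro reaches_sum_mset reaches_image[OF diagonal_supplies_4[OF uvw(2)]] parcs_append_right) auto
    also have "\<dots> = repeat_mset 4 T'"
      unfolding T'_def by (induction T) simp_all
    finally have 1: "?R (2 + n) M' (repeat_mset 4 T')" .
    have "?R (2 + n) (image_mset (\<lambda>x. v @ x) (repeat_mset 4 T)) (image_mset (\<lambda>x. v @ x) {#w#})"
      by (intro reaches_image[OF T(3)] parcs_append_left uvw)
    then have 2: "?R (2 + n) (repeat_mset 4 T') {#u#}"
      by (simp add: T'_def uvw(1) image_repeat_mset)
    have "set_mset T' \<subseteq> ?V (2 + n)"
      using T(1) uvw(2) unfolding T'_def pverts_cartesian_power by fastforce
    with 1 2 show ?thesis by blast
  qed
  ultimately have "solves_by_fours (2 + n) M'"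
    unfolding solves_by_fours_def by blast
  moreover have "size M' = 5 * size M"
    by (simp add: M'_def numeral_eq_Suc)
  ultimately show ?thesis by blast
qed

lemma optimal_le_power_5:
  assumes "solves_by_fours n M"
  shows "optimal_pebbling_number (cartesian_power C5 (2 * k + n)) \<le> 5 ^ k * size M"
proof -
  have "\<exists>M'. solves_by_fours (2 * k + n) M' \<and> size M' = 5 ^ k * size M"
  proof (induction k)
    case 0
    then show ?case using assms by auto
  next
    case (Suc k)
    then obtain M' where "solves_by_fours (2 * k + n) M'" "size M' = 5 ^ k * size M"
      by blast
    with solves_by_fours_step[of "2 * k + n" M'] show ?case
      by (auto simp: algebra_simps)
  qed
  then show ?thesis
    using optimal_le_solves_by_fours by metis
qed

section \<open>The base distributions\<close>

lemma solves_by_fours_1: "solves_by_fours 1 (replicate_mset 4 [0])"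
proof -
  have "reaches (cartesian_power C5 1) (replicate_mset 4 [0]) {#v#}"
    if "v \<in> pverts (cartesian_power C5 1)" for v
    using that four_on_C5 by (cases v) (auto simp: pverts_cartesian_power pverts_C5)
  moreover have "[0] \<in> pverts (cartesian_power C5 1)"
    by (simp add: pverts_cartesian_power pverts_C5)
  ultimately show ?thesis
    unfolding solves_by_fours_def by (auto intro!: exI[of _ "{#[0]#}"] reaches_refl)
qed

text \<open>Distributions on \<open>C\<^sub>5\<close> are written as lists of values.\<close>

definition heap :: "nat list \<Rightarrow> nat multiset" where
  "heap xs = (\<Sum>i\<leftarrow>[0..<length xs]. replicate_mset (xs ! i) i)"

text \<open>An executable checker for move lists; an illegal move gives \<open>None\<close>.\<close>

fun play :: "(nat \<times> nat) list \<Rightarrow> nat list \<Rightarrow> nat list option" where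
  "play [] xs = Some xs"
| "play ((i, j) # ms) xs =
    (if i < 5 \<and> j < 5 \<and> cycle_dist i j = 1 \<and> xs ! i \<ge> 2
     then play ms (xs[i := xs ! i - 2, j := xs ! j + 1]) else None)"

lemma count_heap: "count (heap xs) i = (if i < length xs then xs ! i else 0)"
proof -
  have "count (heap xs) i = (\<Sum>j<length xs. if j = i then xs ! j else 0)"
    by (simp add: heap_def count_sum flip: sum_set_upt_conv_sum_list_nat atLeast0LessThan)
  then show ?thesis by simp
qed

lemma size_heap: "size (heap xs) = sum_list xs"
proof -
  have "size (\<Sum>i\<leftarrow>is. replicate_mset (xs ! i) i) = sum_list (map ((!) xs) is)" for "is"
    by (induction "is") auto
  then show ?thesis by (simp add: heap_def map_nth)
qed

lemma cycle_dist_1: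
  assumes "i < 5" "j < 5" "cycle_dist i j = 1"
  shows "(i, j) \<in> parcs C5" "i \<noteq> j"
  using cycle_path[OF assms(1,2)] assms(3) by (auto simp: cycle_dist_def)

lemma reaches_play:
  assumes "play ms xs = Some ys" "length xs = 5" "ys ! v \<ge> k" "v < 5"
  shows "reaches C5 (heap xs) (replicate_mset k v)"
  using assms
proof (induction ms xs rule: play.induct)
  case (1 xs)
  then show ?case
    by (intro reaches.sub) (simp add: count_heap flip: count_le_replicate_mset_subset_eq)
next
  case (2 i j ms xs)
  then have m: "i < 5" "j < 5" "cycle_dist i j = 1" "xs ! i \<ge> 2"
    by (auto split: if_splits)
  \<comment> \<open>The pebbles that remain after the removal and before the placement, shared by
    both sides of the rule \<open>step\<close>.\<close>
  define zs where "zs = xs[i := xs ! i - 2]"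
  have arc: "(i, j) \<in> parcs C5" "i \<noteq> j"
    using cycle_dist_1 m by auto
  have "reaches C5 (heap (xs[i := xs ! i - 2, j := xs ! j + 1])) (replicate_mset k v)"
    using 2 m by simp
  also have "heap (xs[i := xs ! i - 2, j := xs ! j + 1]) = add_mset j (heap zs)"
    using m arc(2) "2.prems"(2) by (auto simp: multiset_eq_iff count_heap zs_def nth_list_update)
  finally have "reaches C5 (add_mset i (add_mset i (heap zs))) (replicate_mset k v)"
    by (rule reaches.step[OF arc(1)])
  also have "add_mset i (add_mset i (heap zs)) = heap xs"
    using m "2.prems"(2) by (auto simp: multiset_eq_iff count_heap zs_def nth_list_update)
  finally show ?case .
qed

lemma heap_supplies_8:
  assumes "v < 5"
  shows "reaches C5 (heap [4,3,3,4,3]) (replicate_mset 8 v)"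
proof -
  \<comment> \<open>The move lists are certificates for the targets 0 to 4, in this order.\<close>
  have "\<forall>v \<in> set [0..<5]. \<exists>ms \<in> set
      [[(1,0),(2,1),(1,0),(3,4),(4,0),(4,0)],
       [(0,1),(0,1),(2,1),(3,4),(3,2),(2,1),(4,0),(4,0),(0,1)],
       [(0,1),(0,4),(1,2),(1,2),(3,2),(3,2),(4,3),(4,3),(3,2)],
       [(0,4),(1,2),(2,3),(2,3),(4,3),(4,3)],
       [(0,4),(0,4),(1,2),(2,3),(2,3),(3,4),(3,4),(3,4)]].
      case play ms [4,3,3,4,3] of None \<Rightarrow> False | Some ys \<Rightarrow> 8 \<le> ys ! v"
    by code_simp
  moreover have "v \<in> set [0..<5]" using assms by simp
  ultimately obtain ms where "case play ms [4,3,3,4,3] of None \<Rightarrow> False | Some ys \<Rightarrow> 8 \<le> ys ! v"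
    by blast
  then show ?thesis
    using assms by (auto split: option.splits intro: reaches_play)
qed

lemma heap_supplies_4:
  assumes "v < 5"
  shows "reaches C5 (heap [3,1,2,2,1]) (replicate_mset 4 v)"
proof -
  \<comment> \<open>Again one certificate per target, in the order 0 to 4.\<close>
  have "\<forall>v \<in> set [0..<5]. \<exists>ms \<in> set
      [[(2,1),(1,0)],
       [(0,1),(2,1),(3,4),(4,0),(0,1)],
       [(0,1),(1,2),(3,2)],
       [(0,4),(2,3),(4,3)],
       [(0,4),(2,1),(1,0),(0,4),(3,4)]].
      case play ms [3,1,2,2,1] of None \<Rightarrow> False | Some ys \<Rightarrow> 4 \<le> ys ! v"
    by code_simp
  moreover have "v \<in> set [0..<5]" using assms by simp
  ultimately obtain ms where "case play ms [3,1,2,2,1] of None \<Rightarrow> False | Some ys \<Rightarrow> 4 \<le> ys ! v"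
    by blast
  then show ?thesis
    using assms by (auto split: option.splits intro: reaches_play)
qed

text \<open>For a target with first coordinate \<open>x\<close>, each heap is collected on
  \<open>x\<close> along the first coordinate. This produces the stacks 8, 8 and 4 of the cube in
  the fibre of \<open>x\<close>; all three sizes are multiples of four, hence the multiplicities 2,
  2, 1 in \<open>T\<close>.\<close>

lemma solves_by_fours_4: "\<exists>M. solves_by_fours 4 M \<and> size M = 43"
proof -
  let ?V = "pverts (cartesian_power C5 4)" and ?R = "reaches (cartesian_power C5 4)"
  let ?I = "\<lambda>xs y. image_mset (\<lambda>x. [x] @ y) (heap xs)"
  define M where "M = ?I [4,3,3,4,3] [0,0,0] + ?I [4,3,3,4,3] [2,2,2] + ?I [3,1,2,2,1] [3,3,3]"
  have fibre: "?R (?I xs y) (replicate_mset k ([x] @ y))"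
    if "reaches C5 (heap xs) (replicate_mset k x)" "y \<in> pverts (cartesian_power C5 3)" for xs k x y
    using reaches_image[OF that(1), of "\<lambda>x. [x] @ y" "cartesian_power C5 (1 + 3)"] that(2)
      parcs_append_right parcs_singleton pair_graph_C5 by fastforce
  have y: "[0,0,0] \<in> pverts (cartesian_power C5 3)" "[2,2,2] \<in> pverts (cartesian_power C5 3)"
    "[3,3,3] \<in> pverts (cartesian_power C5 3)"
    by (simp_all add: pverts_cartesian_power pverts_C5)
  have "\<exists>T. set_mset T \<subseteq> ?V \<and> ?R M (repeat_mset 4 T) \<and> ?R (repeat_mset 4 T) {#v#}"
    if v: "v \<in> ?V" for v
  proof -
    obtain x w where xw: "v = [x] @ w" "x < 5" "w \<in> pverts (cartesian_power C5 3)"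
      using v by (cases v) (auto simp: pverts_cartesian_power pverts_C5)
    define T where "T = {#[x,0,0,0], [x,0,0,0], [x,2,2,2], [x,2,2,2], [x,3,3,3]#}"
    let ?S = "stacks [([0,0,0], 8), ([2,2,2], 8), ([3,3,3], 4)]"
    have T: "image_mset (\<lambda>y. [x] @ y) ?S = repeat_mset 4 T"
      by (simp add: T_def multiset_eq_iff)
    have "?R M (replicate_mset 8 ([x] @ [0,0,0]) + replicate_mset 8 ([x] @ [2,2,2]) +
        replicate_mset 4 ([x] @ [3,3,3]))"
      unfolding M_def using xw(2) y
      by (intro reaches_add fibre heap_supplies_8 heap_supplies_4)
    also have "\<dots> = image_mset (\<lambda>y. [x] @ y) ?S"
      by simp
    finally have "?R M (repeat_mset 4 T)"
      unfolding T .
    moreover have "reaches (cartesian_power C5 (1 + 3)) (image_mset (\<lambda>y. [x] @ y) ?S)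
        (image_mset (\<lambda>y. [x] @ y) {#w#})"
      using xw(2)
      by (intro reaches_image[OF solves_C5_cube[OF xw(3)]] parcs_append_left)
        (auto simp: pverts_cartesian_power pverts_C5)
    then have "?R (repeat_mset 4 T) {#v#}"
      unfolding T xw(1) by simp
    moreover have "set_mset T \<subseteq> ?V"
      using xw(2) by (simp add: T_def pverts_cartesian_power pverts_C5)
    ultimately show ?thesis by blast
  qed
  moreover have "x < 5" if "x \<in># heap xs" "length xs = 5" for x xs
    using that by (auto simp: count_heap simp flip: count_greater_zero_iff split: if_splits)
  then have "set_mset M \<subseteq> ?V"
    by (auto simp: M_def pverts_cartesian_power pverts_C5)
  ultimately have "solves_by_fours 4 M"
    unfolding solves_by_fours_def by blast
  moreover have "size M = 43"
    by (simp add: M_def size_heap)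
  ultimately show ?thesis by blast
qed

section \<open>The final bounds\<close>

lemma optimal_C5_odd: "optimal_pebbling_number (cartesian_power C5 (2 * k + 1)) \<le> 4 * 5 ^ k"
  using optimal_le_power_5[OF solves_by_fours_1, of k] by simp

text \<open>For \<open>m\<close> at least 2 the base of size 43 gives the constant 43/25. The case
  \<open>m = 1\<close> lies below that base and uses size 8, which is less than 44/5.\<close>

lemma optimal_C5_even:
  assumes "m \<ge> 1"
  shows "real (optimal_pebbling_number (cartesian_power C5 (2 * m))) \<le> 44 / 25 * 5 ^ m"
proof (cases "m = 1")
  case True
  have "optimal_pebbling_number (cartesian_power C5 2)
      \<le> size (stacks [([0,0], 4), ([2,2], 2), ([3,3 :: nat], 2)])"
    by (intro optimal_pebbling_number_le pair_graph_cartesian_power pair_graph_C5 solves_C5_square)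
      (auto simp: pverts_cartesian_power pverts_C5)
  then show ?thesis
    using True by simp
next
  case False
  then obtain k where m: "m = k + 2"
    using assms that[of "m - 2"] by auto
  obtain M where "solves_by_fours 4 M" "size M = 43"
    using solves_by_fours_4 by blast
  moreover have "2 * m = 2 * k + 4" by (simp add: m)
  ultimately have "optimal_pebbling_number (cartesian_power C5 (2 * m)) \<le> 5 ^ k * 43"
    using optimal_le_power_5[of 4 M k] by simp
  then have "real (optimal_pebbling_number (cartesian_power C5 (2 * m))) \<le> real (5 ^ k * 43)"
    by (simp only: of_nat_le_iff)
  also have "\<dots> \<le> 44 / 25 * 5 ^ m"
    by (simp add: m)
  finally show ?thesis .
qed

lemma optimal_C5_le:
  assumes "d \<ge> 1"
  shows "real (optimal_pebbling_number (cartesian_power C5 d)) \<le> 4 / sqrt 5 * 5 powr (real d / 2)"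
proof (cases "even d")
  case True
  then obtain m where d: "d = 2 * m" by blast
  \<comment> \<open>Equivalent to 44/25 \<le> 4 / \<open>sqrt 5\<close>, which compares the even
    constant with the general one.\<close>
  have "sqrt 5 \<le> 100 / (44::real)"
    by (rule real_le_lsqrt) (simp_all add: power2_eq_square)
  then have "44 / 25 * (5::real) ^ m \<le> 4 / sqrt 5 * 5 ^ m"
    by (intro mult_right_mono) (simp_all add: field_simps)
  with optimal_C5_even[of m] assms show ?thesis
    by (simp add: d powr_realpow)
next
  case False
  then obtain k where d: "d = 2 * k + 1" by (auto elim: oddE)
  \<comment> \<open>For odd \<open>d\<close> the claimed bound is exactly
    \<open>4 * 5 ^ k\<close>.\<close>
  have "5 powr (real d / 2) = sqrt 5 * (5::real) ^ k"
    by (simp add: d add_divide_distrib powr_add powr_half_sqrt powr_realpow)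
  moreover have "real (optimal_pebbling_number (cartesian_power C5 d)) \<le> real (4 * 5 ^ k)"
    unfolding d of_nat_le_iff by (rule optimal_C5_odd)
  ultimately show ?thesis by simp
qed

theorem theorem5p5:
  shows "(\<forall>m::nat. m \<ge> 1 \<longrightarrow>
            real (optimal_pebbling_number (cartesian_power (cycle_graph 5) (2 * m)))
              \<le> 44 / 25 * 5 ^ m)
       \<and> (\<forall>d::nat. d \<ge> 1 \<longrightarrow>
            real (optimal_pebbling_number (cartesian_power (cycle_graph 5) d))
              \<le> 4 / sqrt 5 * 5 powr (real d / 2))
       \<and> (\<lambda>d::nat. real (optimal_pebbling_number (cartesian_power (cycle_graph 5) d)))
            \<in> O(\<lambda>d. sqrt 5 ^ d)"
proof (intro conjI allI impI)
  have "5 powr (real d / 2) = sqrt 5 ^ d" for d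
  proof -
    have "5 powr (real d / 2) = (5 powr (1 / 2)) powr real d"
      by (simp add: powr_powr)
    then show ?thesis
      by (simp add: powr_half_sqrt powr_realpow)
  qed
  then show "(\<lambda>d::nat. real (optimal_pebbling_number (cartesian_power C5 d))) \<in> O(\<lambda>d. sqrt 5 ^ d)"
    using optimal_C5_le
    by (intro bigoI[of _ "4 / sqrt 5"] eventually_at_top_linorderI[of 1]) simp
qed (use optimal_C5_even optimal_C5_le in auto)

end
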